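(* Let $X$ be an infinite $\mathbb{Z}^2$-subshift with finitely many nonexpansive rays (up to translation), each of which has rational slope and is closing. Then there is a recoding $Y$ of $X$ which is polygonal.
   Context: Subshifts and coding. For a finite alphabet $\mathcal{A}$ (discrete topology), a $\mathbb{Z}^2$-subshift is a closed subset $X\subset\mathcal{A}^{\mathbb{Z}^2}$ (product topology) invariant under the shifts $(T^ux)(v)=x(u+v)$, $u\in\mathbb{Z}^2$. For $A,B\subset\mathbb{R}^2$, $A$ $X$-codes $B$ if whenever $x,x'\in X$ agree on $A\cap\mathbb{Z}^2$ they agree on $B\cap\mathbb{Z}^2$. Recoding. A $\mathbb{Z}^2$-subshift $Y$ (possibly over another finite alphabet) is a recoding of $X$ if there are a finite set $F\subset\mathbb{Z}^2$ and a homeomorphism $\Psi:X\to Y$ commuting with the shift actions such that for all $(i,j)\in\mathbb{Z}^2$ and $x,x'\in X$: $\Psi(x)(i,j)=\Psi(x')(i,j)$ if and only if $x$ and $x'$ agree on $F+(i,j)$. Polygonal. An integer polygon is a polygon in $\mathbb{R}^2$ (including its interior) with all vertices in $\mathbb{Z}^2$. A convex integer polygon $\mathcal{P}$ is a coding polygon for an infinite $\mathbb{Z}^2$-subshift $X$ if for every vertex $v$ of $\mathcal{P}$, $\mathcal{P}\setminus\{v\}$ $X$-codes $\{v\}$. $X$ is polygonal if it is infinite and has a coding polygon. Rays. A ray is a translate of $\{tv: t\ge 0\}$, $v\neq0$ in $\mathbb{R}^2$, oriented in the direction of increasing $t$. A half space $H\subset\mathbb{R}^2$ (open or closed half plane)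 is expansive for $X$ if $H$ $X$-codes $\mathbb{R}^2$, and nonexpansive otherwise; this depends only on $H$ up to translation. A ray $\ell$ is expansive (nonexpansive) for $X$ if the half space $H$ bounded by the line containing $\ell$ and lying to the left of $\ell$ (so that $\ell$ has the orientation that $\partial H$ inherits from $H$) is expansive (nonexpansive). Rational slope includes vertical. Closing. Let $L$ be a one-dimensional subspace of $\mathbb{R}^2$ of rational slope bounding a nonexpansive closed half space $H$, and let $L_0$ be the line in the complement of $H$ closest to $L$ among lines of the form $z+L$, $z\in\mathbb{Z}^2$. A block in $L_0\cap\mathbb{Z}^2$ is the intersection of $\mathbb{Z}^2$ with a connected segment of $L_0$. $H$ is closing if there is $N>0$ such that for every block $\mathcal{B}$ in $L_0\cap\mathbb{Z}^2$ of length at least $N$, $H\cup\mathcal{B}$ $X$-codes $H\cup L_0$. A ray in $L$ with the orientation $L=\partial H$ inherits from $H$ (i.e. $H$ lies to its left) is then called closing; a closing ray is by definition nonexpansive and of rational slope. *)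

theory Defs
  imports "HOL-Analysis.Analysis"
begin

section \<open>Subshifts and coding\<close>

type_synonym 'a config = "int \<times> int \<Rightarrow> 'a"

definition full_shift :: "'a set \<Rightarrow> 'a config topology" where
  "full_shift A = product_topology (\<lambda>_. discrete_topology A) UNIV"

definition shift :: "int \<times> int \<Rightarrow> 'a config \<Rightarrow> 'a config" where
  "shift u x = (\<lambda>v. x (u + v))"

definition subshift :: "'a set \<Rightarrow> 'a config set \<Rightarrow> bool" where
  "subshift A X \<longleftrightarrow>
     finite A \<and> closedin (full_shift A) X \<and> (\<forall>u. shift u ` X \<subseteq> X)"

definition emb :: "int \<times> int \<Rightarrow> real \<times> real" where
  "emb = map_prod real_of_int real_of_int"

definition agree_on :: "(int \<times> int) set \<Rightarrow> 'a config \<Rightarrow> 'a config \<Rightarrow> bool" where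
  "agree_on S x x' \<longleftrightarrow> (\<forall>u\<in>S. x u = x' u)"

definition codes :: "'a config set \<Rightarrow> (real \<times> real) set \<Rightarrow> (real \<times> real) set \<Rightarrow> bool" where
  "codes X S T \<longleftrightarrow>
     (\<forall>x\<in>X. \<forall>x'\<in>X. agree_on (emb -` S) x x' \<longrightarrow> agree_on (emb -` T) x x')"


section \<open>Recodings\<close>

definition recoding ::
  "'a set \<Rightarrow> 'a config set \<Rightarrow> 'b set \<Rightarrow> 'b config set \<Rightarrow> bool" where
  "recoding A X B Y \<longleftrightarrow>
     subshift B Y \<and>
     (\<exists>F \<Psi>. finite F \<and>
        homeomorphic_map (subtopology (full_shift A) X) (subtopology (full_shift B) Y) \<Psi> \<and>
        (\<forall>u. \<forall>x\<in>X. \<Psi> (shift u x) = shift u (\<Psi> x)) \<and>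
        (\<forall>u. \<forall>x\<in>X. \<forall>x'\<in>X. \<Psi> x u = \<Psi> x' u \<longleftrightarrow> agree_on ((\<lambda>f. f + u) ` F) x x'))"


section \<open>Coding polygons\<close>

text \<open>A convex polygon with its interior is a two-dimensional polytope in the plane;
  its vertices are its extreme points.\<close>

definition convex_integer_polygon :: "(real \<times> real) set \<Rightarrow> bool" where
  "convex_integer_polygon P \<longleftrightarrow>
     polytope P \<and> interior P \<noteq> {} \<and> (\<forall>v. v extreme_point_of P \<longrightarrow> v \<in> range emb)"

definition coding_polygon :: "'a config set \<Rightarrow> (real \<times> real) set \<Rightarrow> bool" where
  "coding_polygon X P \<longleftrightarrow>
     convex_integer_polygon P \<and> (\<forall>v. v extreme_point_of P \<longrightarrow> codes X (P - {v}) {v})"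

definition polygonal :: "'a config set \<Rightarrow> bool" where
  "polygonal X \<longleftrightarrow> infinite X \<and> (\<exists>P. coding_polygon X P)"


section \<open>Rays and half spaces\<close>

definition ray :: "real \<times> real \<Rightarrow> real \<times> real \<Rightarrow> (real \<times> real) set" where
  "ray p v = {p + t *\<^sub>R v | t. t \<ge> 0}"

text \<open>The closed half plane to the left of the line through \<open>p\<close> oriented by \<open>v\<close>,
  i.e. the points \<open>z\<close> with \<open>det (v, z - p) \<ge> 0\<close>.\<close>

definition left_half_space :: "real \<times> real \<Rightarrow> real \<times> real \<Rightarrow> (real \<times> real) set" where
  "left_half_space p v = {z. fst v * snd (z - p) - snd v * fst (z - p) \<ge> 0}"

definition expansive :: "'a config set \<Rightarrow> (real \<times> real) set \<Rightarrow> bool" where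
  "expansive X H \<longleftrightarrow> codes X H UNIV"

text \<open>A set which is a ray determines \<open>p\<close>, and \<open>v\<close> up to a positive factor, so in the
  definitions for rays below the choice of \<open>p\<close> and \<open>v\<close> is immaterial. For a subshift,
  expansiveness of a half space is invariant under translation, and the open and the closed
  half space are expansive simultaneously; we use the closed one.\<close>

definition nonexpansive_ray :: "'a config set \<Rightarrow> (real \<times> real) set \<Rightarrow> bool" where
  "nonexpansive_ray X l \<longleftrightarrow>
     (\<exists>p v. v \<noteq> 0 \<and> l = ray p v \<and> \<not> expansive X (left_half_space p v))"

definition rational_slope :: "real \<times> real \<Rightarrow> bool" where
  "rational_slope v \<longleftrightarrow> fst v = 0 \<or> snd v / fst v \<in> \<rat>"

definition rational_ray :: "(real \<times> real) set \<Rightarrow> bool" where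
  "rational_ray l \<longleftrightarrow> (\<exists>p v. v \<noteq> 0 \<and> l = ray p v \<and> rational_slope v)"

definition translates :: "((real \<times> real) set \<times> (real \<times> real) set) set" where
  "translates = {(S, T). \<exists>w. T = (+) w ` S}"


section \<open>Closing\<close>

definition lattice_lines :: "(real \<times> real) set \<Rightarrow> (real \<times> real) set set" where
  "lattice_lines L = {(+) (emb z) ` L | z. True}"

definition closest_line ::
  "(real \<times> real) set \<Rightarrow> (real \<times> real) set \<Rightarrow> (real \<times> real) set \<Rightarrow> bool" where
  "closest_line H L L0 \<longleftrightarrow>
     L0 \<in> lattice_lines L \<and> L0 \<subseteq> - H \<and>
     (\<forall>L'\<in>lattice_lines L. L' \<subseteq> - H \<longrightarrow> setdist L L0 \<le> setdist L L')"

definition blocks :: "(real \<times> real) set \<Rightarrow> (real \<times> real) set set" where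
  "blocks L0 = {range emb \<inter> closed_segment a b | a b. a \<in> L0 \<and> b \<in> L0}"

text \<open>The length of a block is its number of lattice points; blocks are finite.\<close>

definition closing_half_space :: "'a config set \<Rightarrow> (real \<times> real) set \<Rightarrow> bool" where
  "closing_half_space X H \<longleftrightarrow>
     (\<exists>v L0. v \<noteq> 0 \<and> rational_slope v \<and> H = left_half_space 0 v \<and> \<not> expansive X H \<and>
        closest_line H (span {v}) L0 \<and>
        (\<exists>N>0. \<forall>B\<in>blocks L0. card B \<ge> N \<longrightarrow> codes X (H \<union> B) (H \<union> L0)))"

text \<open>Rays are considered up to translation: a ray is closing if its translates lying in a
  one-dimensional subspace are.\<close>

definition closing_ray :: "'a config set \<Rightarrow> (real \<times> real) set \<Rightarrow> bool" where
  "closing_ray X l \<longleftrightarrow>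
     (\<exists>p v. v \<noteq> 0 \<and> l = ray p v \<and> closing_half_space X (left_half_space 0 v))"

end

theory Submission
  imports Defs
begin

text \<open>
  The subshift \<open>X\<close> itself has a coding polygon, so the only recoding needed is a renaming of the
  alphabet by natural numbers.

  By shift invariance, an integer polygon \<open>P\<close> is a coding polygon as soon as at every vertex \<open>v\<close>
  the lattice points \<open>s \<noteq> 0\<close> with \<open>v + s \<in> P\<close> code the origin. The polygon used is the zonotope
  spanned by all nonzero lattice vectors in a large square: at each of its vertices, exactly those
  of these vectors that lie in some open half plane can be added without leaving the polygon
  (\<open>zonotope_vertex\<close>). So it suffices to find a square so large that, for every line
  through the origin which avoids its nonzero lattice points, the lattice points of the square
  strictly to the left of that line code the origin (\<open>uniform_coding\<close>).

  Since the directions form a compact circle, this may be shown near one direction \<open>v\<close> at a time.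
  If \<open>v\<close> is expansive, a finite set strictly to the left of \<open>v\<close> codes the origin
  (\<open>expansive_finite_coding\<close>), and it stays strictly to the left of all nearby directions. If
  \<open>v\<close> is nonexpansive and closing, then for each of the two orientations of the line spanned by
  \<open>v\<close> the origin is coded by a finite set each of whose points lies strictly to the left of \<open>v\<close> or
  is on the corresponding half of that line (\<open>closing_finite_coding\<close>). A direction close to \<open>v\<close>
  which is not parallel to \<open>v\<close> has all of one of these two sets strictly to its left.
\<close>

section \<open>Coding by finite sets\<close>

definition codes_point :: "'a config set \<Rightarrow> (int \<times> int) set \<Rightarrow> int \<times> int \<Rightarrow> bool" where
  "codes_point X S u \<longleftrightarrow> (\<forall>x\<in>X. \<forall>x'\<in>X. agree_on S x x' \<longrightarrow> x u = x' u)"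

lemma codes_iff_codes_point: "codes X S T \<longleftrightarrow> (\<forall>u. emb u \<in> T \<longrightarrow> codes_point X (emb -` S) u)"
  unfolding codes_def codes_point_def agree_on_def by blast

lemma codes_point_mono: "codes_point X S u \<Longrightarrow> S \<subseteq> T \<Longrightarrow> codes_point X T u"
  unfolding codes_point_def agree_on_def by blast

lemma emb_simps [simp]:
  "emb (u + v) = emb u + emb v" "emb (u - v) = emb u - emb v" "emb (- u) = - emb u" "emb 0 = 0"
  by (cases u; cases v; simp add: emb_def zero_prod_def)+

lemma emb_eq_iff [simp]: "emb u = emb v \<longleftrightarrow> u = v"
  by (cases u; cases v; simp add: emb_def)

lemma codes_point_translate:
  assumes X: "subshift A X" and S: "codes_point X S u"
  shows "codes_point X ((\<lambda>s. s + w) ` S) (u + w)"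
  unfolding codes_point_def
proof (intro ballI impI)
  fix x x' assume x: "x \<in> X" "x' \<in> X" and ag: "agree_on ((\<lambda>s. s + w) ` S) x x'"
  have "shift w x \<in> X" "shift w x' \<in> X"
    using X x unfolding subshift_def by blast+
  moreover have "agree_on S (shift w x) (shift w x')"
    using ag by (auto simp: agree_on_def shift_def add.commute)
  ultimately show "x (u + w) = x' (u + w)"
    using S unfolding codes_point_def shift_def by (metis add.commute)
qed

text \<open>Coding a point is a finite matter by compactness: the pairs of configurations differing at
  \<open>u\<close> form a compact set, which is covered by the open sets of the pairs differing at \<open>s\<close>,
  for \<open>s \<in> S\<close>.\<close>

lemma codes_point_finite_subset:
  assumes X: "subshift A X" and S: "codes_point X S u"
  shows "\<exists>F. finite F \<and> F \<subseteq> S \<and> codes_point X F u"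
proof -
  define K where "K = subtopology (full_shift A) X"
  define Z where "Z = prod_topology K K"
  define W where "W s = {p \<in> topspace Z. fst p s \<noteq> snd p s}" for s
  have fin: "finite A" and cl: "closedin (full_shift A) X"
    using X by (auto simp: subshift_def)
  have tK: "topspace K = X"
    using closedin_subset[OF cl] by (auto simp: K_def)
  have tZ: "topspace Z = X \<times> X" by (simp add: Z_def tK)
  have "compact_space (full_shift A)"
    using fin by (auto simp: full_shift_def compact_space_product_topology compact_space_discrete_topology)
  then have "compact_space K"
    using cl unfolding K_def by (metis closedin_compact_space compact_space_subtopology)
  then have comp: "compact_space Z"
    by (simp add: Z_def compact_space_prod_topology)
  have proj: "continuous_map K (discrete_topology A) (\<lambda>x. x s)" for s
    unfolding K_def full_shift_def
    by (intro continuous_map_from_subtopology continuous_map_product_projection) simp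
  have cont: "continuous_map Z (discrete_topology (A \<times> A)) (\<lambda>p. (fst p s, snd p s))" for s
    unfolding prod_topology_discrete_topology Z_def
    by (intro continuous_map_paired[THEN iffD2] conjI
        continuous_map_compose[OF continuous_map_fst proj, unfolded o_def]
        continuous_map_compose[OF continuous_map_snd proj, unfolded o_def])
  have X_A: "x s \<in> A" if "x \<in> X" for x s
    using closedin_subset[OF cl] that by (auto simp: full_shift_def)
  have W_eq: "W s = {p \<in> topspace Z. (fst p s, snd p s) \<in> {(a, b). a \<in> A \<and> b \<in> A \<and> a \<noteq> b}}" for s
    by (simp add: W_def tZ set_eq_iff) (metis X_A)
  have op: "openin Z (W s)" for s
    unfolding W_eq by (rule openin_continuous_map_preimage[OF cont]) auto
  have "closedin Z (W u)"
    unfolding W_eq by (rule closedin_continuous_map_preimage[OF cont]) auto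
  then have "compactin Z (W u)"
    using comp by (rule closedin_compact_space[rotated])
  moreover have "W u \<subseteq> \<Union> (W ` S)"
    using S by (fastforce simp: W_def tZ codes_point_def agree_on_def)
  ultimately obtain \<F> where \<F>: "finite \<F>" "\<F> \<subseteq> W ` S" "W u \<subseteq> \<Union> \<F>"
    using op unfolding compactin_def by (metis (no_types, lifting) imageE)
  then obtain F where F: "F \<subseteq> S" "finite F" "\<F> = W ` F"
    by (meson finite_subset_image)
  have "codes_point X F u"
    unfolding codes_point_def agree_on_def
  proof (intro ballI impI, rule ccontr)
    fix x x' assume x: "x \<in> X" "x' \<in> X" and ag: "\<forall>s\<in>F. x s = x' s" and "x u \<noteq> x' u"
    then have "(x, x') \<in> W u" by (simp add: W_def tZ)
    then have "(x, x') \<in> \<Union> (W ` F)" using \<F> F by blast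
    then show False using ag by (auto simp: W_def)
  qed
  with F show ?thesis by blast
qed

lemma codes_point_finite_at_0:
  assumes X: "subshift A X" and S: "codes_point X S u"
  shows "\<exists>F. finite F \<and> (\<forall>s\<in>F. s + u \<in> S) \<and> codes_point X F 0"
proof -
  obtain F where F: "finite F" "F \<subseteq> S" "codes_point X F u"
    using codes_point_finite_subset[OF X S] by blast
  have "codes_point X ((\<lambda>s. s + (- u)) ` F) (u + (- u))"
    by (rule codes_point_translate[OF X F(3)])
  with F show ?thesis by (intro exI[of _ "(\<lambda>s. s + (- u)) ` F"]) auto
qed

section \<open>Half planes and the points strictly to the left of a direction\<close>

definition cross :: "real \<times> real \<Rightarrow> real \<times> real \<Rightarrow> real" where
  "cross v z = fst v * snd z - snd v * fst z"

lemma cross_add [simp]: "cross v (y + z) = cross v y + cross v z"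
  and cross_minus [simp]: "cross v (- z) = - cross v z"
  and cross_scaleR [simp]: "cross v (c *\<^sub>R z) = c * cross v z"
  and cross_scaleR_left: "cross (c *\<^sub>R v) z = c * cross v z"
  and cross_0 [simp]: "cross v 0 = 0"
  by (auto simp: cross_def algebra_simps)

lemma left_half_space_0: "z \<in> left_half_space 0 v \<longleftrightarrow> cross v z \<ge> 0"
  by (simp add: left_half_space_def cross_def)

lemma lattice_point_to_the_right:
  assumes "v \<noteq> 0"
  shows "\<exists>u. cross v (emb u) < 0"
proof -
  from assms consider "fst v > 0" | "fst v < 0" | "snd v > 0" | "snd v < 0"
    by (cases v) (auto simp: zero_prod_def, linarith+)
  then show ?thesis
  proof cases
    case 1 then show ?thesis by (intro exI[of _ "(0, -1)"]) (simp add: cross_def emb_def)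
  next
    case 2 then show ?thesis by (intro exI[of _ "(0, 1)"]) (simp add: cross_def emb_def)
  next
    case 3 then show ?thesis by (intro exI[of _ "(1, 0)"]) (simp add: cross_def emb_def)
  next
    case 4 then show ?thesis by (intro exI[of _ "(-1, 0)"]) (simp add: cross_def emb_def)
  qed
qed

text \<open>The half plane codes a lattice point \<open>u\<close> outside it. A point \<open>s + u\<close> of
  the closed half plane is strictly further to the left than \<open>u\<close>, whence the strict inequality
  after translating \<open>u\<close> to the origin.\<close>

lemma expansive_finite_coding:
  assumes X: "subshift A X" and v: "v \<noteq> 0" and exp: "expansive X (left_half_space 0 v)"
  shows "\<exists>F. finite F \<and> (\<forall>s\<in>F. cross v (emb s) > 0) \<and> codes_point X F 0"
proof -
  obtain u where u: "cross v (emb u) < 0" using lattice_point_to_the_right[OF v] by blast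
  have "codes_point X (emb -` left_half_space 0 v) u"
    using exp unfolding expansive_def codes_iff_codes_point by blast
  from codes_point_finite_at_0[OF X this] u show ?thesis
    by (fastforce simp: left_half_space_0)
qed

lemma finite_lattice_points:
  assumes "bounded S"
  shows "finite {z. emb z \<in> S}"
proof -
  obtain B where B: "\<And>x. x \<in> S \<Longrightarrow> norm x \<le> B"
    using assms by (auto simp: bounded_iff)
  define k where "k = \<lceil>B\<rceil>"
  have "{z. emb z \<in> S} \<subseteq> {-k..k} \<times> {-k..k}"
  proof
    fix z assume "z \<in> {z. emb z \<in> S}"
    then have "norm (emb z) \<le> B" using B by blast
    moreover have "\<bar>real_of_int (fst z)\<bar> \<le> norm (emb z)" "\<bar>real_of_int (snd z)\<bar> \<le> norm (emb z)"
      using norm_fst_le[of "fst (emb z)" "snd (emb z)"] norm_snd_le[of "snd (emb z)" "fst (emb z)"]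
      by (simp_all add: emb_def map_prod_def split_beta)
    ultimately have "\<bar>real_of_int (fst z)\<bar> \<le> B" "\<bar>real_of_int (snd z)\<bar> \<le> B" by linarith+
    then have "\<bar>fst z\<bar> \<le> k" "\<bar>snd z\<bar> \<le> k" unfolding k_def by linarith+
    then show "z \<in> {-k..k} \<times> {-k..k}" by (cases z) auto
  qed
  then show ?thesis by (rule finite_subset) auto
qed

lemma rational_slope_lattice_vector:
  assumes "rational_slope v" "v \<noteq> 0"
  shows "\<exists>e. e \<noteq> 0 \<and> emb e \<in> span {v}"
proof (cases "fst v = 0")
  case True
  with assms have "snd v \<noteq> 0" by (cases v) (auto simp: zero_prod_def)
  with True have "emb (0, 1) = (1 / snd v) *\<^sub>R v" by (cases v) (auto simp: emb_def)
  then show ?thesis by (intro exI[of _ "(0, 1)"]) (auto simp: zero_prod_def intro: span_mul span_base)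
next
  case False
  with assms have "snd v / fst v \<in> \<rat>" by (auto simp: rational_slope_def)
  then obtain p q :: int where pq: "q \<noteq> 0" "snd v / fst v = real_of_int p / real_of_int q"
    by (metis Rats_cases' less_irrefl)
  with False have "emb (q, p) = (real_of_int q / fst v) *\<^sub>R v"
    by (cases v) (auto simp: emb_def field_simps)
  with pq show ?thesis
    by (intro exI[of _ "(q, p)"]) (auto simp: zero_prod_def intro: span_mul span_base)
qed

text \<open>For a lattice point \<open>z\<close> of the line closest to the half plane and a lattice vector \<open>e\<close>
  along that line, the block from \<open>z + e\<close> to \<open>z + N e\<close> and the half plane together code \<open>z\<close>.
  Seen from \<open>z\<close>, the block is in direction \<open>e\<close>; and \<open>-e\<close> may take the place of \<open>e\<close>.\<close>

lemma closing_finite_coding: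
  assumes X: "subshift A X" and closing: "closing_half_space X (left_half_space 0 v)"
  shows "\<exists>e. e \<noteq> 0 \<and> (\<forall>d\<in>{e, - e}. \<exists>F. finite F \<and> codes_point X F 0 \<and>
           (\<forall>s\<in>F. cross v (emb s) > 0 \<or> (\<exists>t>0. emb s = t *\<^sub>R emb d)))"
proof -
  define H where "H = left_half_space 0 v"
  obtain v' L0 N where v': "v' \<noteq> 0" "rational_slope v'" and H: "H = left_half_space 0 v'"
    and closest: "closest_line H (span {v'}) L0"
    and N: "N > 0" "\<And>B. B \<in> blocks L0 \<Longrightarrow> card B \<ge> N \<Longrightarrow> codes X (H \<union> B) (H \<union> L0)"
    using closing unfolding closing_half_space_def H_def[symmetric] by blast
  obtain z where L0: "L0 = (+) (emb z) ` span {v'}" and out: "L0 \<subseteq> - H"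
    using closest by (auto simp: closest_line_def lattice_lines_def)
  have z: "emb z \<in> L0"
    unfolding L0 using span_zero by (metis add.right_neutral imageI)
  then have z_right: "cross v (emb z) < 0"
    using out left_half_space_0[of "emb z" v] by (auto simp: H_def)
  obtain e where e: "e \<noteq> 0" "emb e \<in> span {v'}"
    using rational_slope_lattice_vector v' by blast
  have "\<exists>F. finite F \<and> codes_point X F 0 \<and>
           (\<forall>s\<in>F. cross v (emb s) > 0 \<or> (\<exists>t>0. emb s = t *\<^sub>R emb d))"
    if d: "d \<in> {e, - e}" for d
  proof -
    have d: "d \<noteq> 0" "emb d \<in> span {v'}"
      using d e by (auto intro: span_neg)
    define B where
      "B = range emb \<inter> closed_segment (emb z + emb d) (emb z + real N *\<^sub>R emb d)"
    have "emb z + emb d \<in> L0" "emb z + real N *\<^sub>R emb d \<in> L0"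
      unfolding L0 using d by (auto intro: span_mul)
    then have B_block: "B \<in> blocks L0" unfolding B_def blocks_def by blast
    have B_pos: "\<exists>t>0. b = emb z + t *\<^sub>R emb d" if "b \<in> B" for b
    proof -
      from that obtain r where r: "0 \<le> r" "r \<le> 1"
        "b = (1 - r) *\<^sub>R (emb z + emb d) + r *\<^sub>R (emb z + real N *\<^sub>R emb d)"
        by (auto simp: B_def in_segment)
      then have "b = emb z + (1 - r + r * real N) *\<^sub>R emb d"
        by (simp add: algebra_simps)
      moreover have "1 - r + r * real N > 0"
      proof (cases "r = 0")
        case False
        then show ?thesis using r N(1) by (intro add_nonneg_pos) auto
      qed auto
      ultimately show ?thesis by blast
    qed
    have "(\<lambda>j. emb z + real j *\<^sub>R emb d) ` {1..N} \<subseteq> B"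
    proof (intro image_subsetI)
      fix j assume j: "j \<in> {1..N}"
      have "emb z + real j *\<^sub>R emb d = emb (z + (int j * fst d, int j * snd d))"
        by (cases d; cases z) (simp add: emb_def)
      then have "emb z + real j *\<^sub>R emb d \<in> range emb" by blast
      moreover have "emb z + real j *\<^sub>R emb d
          \<in> closed_segment (emb z + emb d) (emb z + real N *\<^sub>R emb d)"
      proof (cases "N = 1")
        case True with j show ?thesis by auto
      next
        case False
        define r where "r = (real j - 1) / (real N - 1)"
        have "r * (real N - 1) = real j - 1" using False N(1) by (simp add: r_def)
        then have "1 - r + r * real N = real j" by (simp add: algebra_simps)
        moreover have "(1 - r) *\<^sub>R (emb z + emb d) + r *\<^sub>R (emb z + real N *\<^sub>R emb d)
            = emb z + (1 - r + r * real N) *\<^sub>R emb d"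
          by (simp add: algebra_simps)
        moreover have "0 \<le> r" "r \<le> 1" using j False by (auto simp: r_def divide_simps)
        ultimately show ?thesis unfolding in_segment by metis
      qed
      ultimately show "emb z + real j *\<^sub>R emb d \<in> B" by (simp add: B_def)
    qed
    moreover have "inj_on (\<lambda>j. emb z + real j *\<^sub>R emb d) {1..N}"
      using d(1) emb_eq_iff[of d 0] by (auto simp: inj_on_def)
    moreover have "finite B"
    proof -
      have "B \<subseteq> emb ` {y. emb y \<in> closed_segment (emb z + emb d) (emb z + real N *\<^sub>R emb d)}"
        by (auto simp: B_def)
      then show ?thesis
        by (rule finite_subset) (intro finite_imageI finite_lattice_points bounded_closed_segment)
    qed
    ultimately have "card B \<ge> N"
      by (metis card_atLeastAtMost card_image card_mono diff_Suc_1)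
    then have "codes_point X (emb -` (H \<union> B)) z"
      using N(2)[OF B_block] z unfolding codes_iff_codes_point by blast
    from codes_point_finite_at_0[OF X this]
    obtain F where F: "finite F" "codes_point X F 0" "\<forall>s\<in>F. s + z \<in> emb -` (H \<union> B)" by blast
    have "cross v (emb s) > 0 \<or> (\<exists>t>0. emb s = t *\<^sub>R emb d)" if "s \<in> F" for s
    proof -
      have "emb s + emb z \<in> H \<or> emb s + emb z \<in> B" using F(3) that by auto
      then show ?thesis
      proof
        assume "emb s + emb z \<in> H"
        then show ?thesis using z_right by (auto simp: H_def left_half_space_0)
      next
        assume "emb s + emb z \<in> B"
        then obtain t where "t > 0" "emb s + emb z = emb z + t *\<^sub>R emb d" using B_pos by blast
        then have "emb s = t *\<^sub>R emb d" by (simp only: add.commute[of "emb s"] add_left_cancel)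
        then show ?thesis using \<open>t > 0\<close> by blast
      qed
    qed
    with F show ?thesis by blast
  qed
  with e(1) show ?thesis by blast
qed

section \<open>Uniformity in the direction\<close>

lemma left_half_space_0_eq_of_ray_eq:
  assumes "v \<noteq> 0" "v' \<noteq> 0" and eq: "ray 0 v = ray p v'"
  shows "left_half_space 0 v' = left_half_space 0 v"
proof -
  have on_ray: "\<exists>c\<ge>0. p + t *\<^sub>R v' = c *\<^sub>R v" if "t \<ge> 0" for t
  proof -
    have "p + t *\<^sub>R v' \<in> ray 0 v" unfolding eq using that by (auto simp: ray_def)
    then show ?thesis by (auto simp: ray_def)
  qed
  obtain a where a: "a \<ge> 0" "p = a *\<^sub>R v" using on_ray[of 0] by auto
  obtain b where b: "b \<ge> 0" "p + v' = b *\<^sub>R v" using on_ray[of 1] by auto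
  have v': "v' = (b - a) *\<^sub>R v" using a b by (simp add: algebra_simps)
  have "b - a > 0"
  proof (rule ccontr)
    assume "\<not> b - a > 0"
    then have neg: "b - a < 0" using v' assms(2) by (cases "b = a") auto
    \<comment> \<open>If \<open>v'\<close> pointed backwards, then at this parameter the ray would reach \<open>-v\<close>.\<close>
    define t where "t = (a + 1) / (a - b)"
    have t: "t \<ge> 0" "a + t * (b - a) = -1"
      using a(1) neg by (auto simp: t_def field_simps)
    obtain c where c: "c \<ge> 0" "p + t *\<^sub>R v' = c *\<^sub>R v" using on_ray[OF t(1)] by blast
    have "p + t *\<^sub>R v' = (a + t * (b - a)) *\<^sub>R v"
      unfolding a(2) v' by (simp add: algebra_simps)
    then have "(-1) *\<^sub>R v = c *\<^sub>R v" using t(2) c(2) by simp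
    then have "-1 = c" using assms(1) by (simp only: scaleR_cancel_right) simp
    then show False using c(1) by simp
  qed
  then show ?thesis
    unfolding v' by (auto simp: left_half_space_0 cross_scaleR_left zero_le_mult_iff)
qed

definition square :: "int \<Rightarrow> (int \<times> int) set" where
  "square m = {d. d \<noteq> 0 \<and> \<bar>fst d\<bar> \<le> m \<and> \<bar>snd d\<bar> \<le> m}"

lemma finite_square: "finite (square m)"
proof (rule finite_subset)
  show "square m \<subseteq> {-m..m} \<times> {-m..m}" by (auto simp: square_def)
qed auto

lemma square_mono: "m \<le> n \<Longrightarrow> square m \<subseteq> square n"
  by (auto simp: square_def)

lemma uminus_square: "d \<in> square m \<Longrightarrow> - d \<in> square m"
  by (auto simp: square_def)

lemma finite_subset_square:
  assumes "finite F" "0 \<notin> F"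
  shows "\<exists>m\<ge>1. F \<subseteq> square m"
  using assms
proof (induction F rule: finite_induct)
  case empty
  then show ?case by (intro exI[of _ 1]) auto
next
  case (insert d F)
  then obtain m where m: "m \<ge> 1" "F \<subseteq> square m" by auto
  define n where "n = max m (max \<bar>fst d\<bar> \<bar>snd d\<bar>)"
  have "F \<subseteq> square n" using m square_mono[of m n] by (auto simp: n_def)
  moreover have "d \<in> square n" using insert.prems by (auto simp: square_def n_def)
  ultimately show ?case using m(1) by (intro exI[of _ n]) (auto simp: n_def)
qed

definition avoids :: "int \<Rightarrow> real \<times> real \<Rightarrow> bool" where
  "avoids m v \<longleftrightarrow> (\<forall>d\<in>square m. cross v (emb d) \<noteq> 0)"

definition left_square :: "int \<Rightarrow> real \<times> real \<Rightarrow> (int \<times> int) set" where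
  "left_square m v = {d \<in> square m. cross v (emb d) > 0}"

lemma open_left_of_all:
  assumes "finite F"
  shows "open {w. \<forall>s\<in>F. cross w (emb s) > 0}"
proof -
  have "open {w. cross w (emb s) > 0}" for s
    unfolding cross_def by (intro open_Collect_less continuous_intros)
  then have "open (\<Inter>s\<in>F. {w. cross w (emb s) > 0})"
    using assms by (intro open_INT) auto
  moreover have "{w. \<forall>s\<in>F. cross w (emb s) > 0} = (\<Inter>s\<in>F. {w. cross w (emb s) > 0})" by auto
  ultimately show ?thesis by simp
qed

text \<open>In the closing case, the square is chosen to contain the vector \<open>e\<close> spanning the line of
  direction \<open>v\<close>. So a direction \<open>w\<close> that avoids the square is not parallel to \<open>e\<close>, and the sign of
  \<open>cross w e\<close> tells which half of the line is to the left of \<open>w\<close>.\<close>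

lemma local_uniform_coding:
  assumes X: "subshift A X" and v: "v \<noteq> 0"
    and dichotomy: "expansive X (left_half_space 0 v) \<or> closing_half_space X (left_half_space 0 v)"
  shows "\<exists>U m. open U \<and> v \<in> U \<and> m \<ge> 1 \<and>
           (\<forall>w\<in>U. avoids m w \<longrightarrow> codes_point X (left_square m w) 0)"
  using dichotomy
proof
  assume "expansive X (left_half_space 0 v)"
  from expansive_finite_coding[OF X v this]
  obtain F where F: "finite F" "\<forall>s\<in>F. cross v (emb s) > 0" "codes_point X F 0" by blast
  have "0 \<notin> F" using F(2) by force
  then obtain m where m: "m \<ge> 1" "F \<subseteq> square m" using finite_subset_square[OF F(1)] by blast
  have "codes_point X (left_square m w) 0" if "w \<in> {w. \<forall>s\<in>F. cross w (emb s) > 0}" for w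
    using m that by (intro codes_point_mono[OF F(3)]) (auto simp: left_square_def)
  with F(2) m(1) open_left_of_all[OF F(1)] show ?thesis by blast
next
  assume "closing_half_space X (left_half_space 0 v)"
  from closing_finite_coding[OF X this]
  obtain e F G where e: "e \<noteq> 0"
    and F: "finite F" "codes_point X F 0"
      "\<And>s. s \<in> F \<Longrightarrow> cross v (emb s) > 0 \<or> (\<exists>t>0. emb s = t *\<^sub>R emb e)"
    and G: "finite G" "codes_point X G 0"
      "\<And>s. s \<in> G \<Longrightarrow> cross v (emb s) > 0 \<or> (\<exists>t>0. emb s = t *\<^sub>R emb (- e))"
    by (simp only: ball_simps) blast
  have emb_e: "emb e \<noteq> 0" using e emb_eq_iff[of e 0] by simp
  have "0 \<notin> F" using F(3)[of 0] emb_e by auto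
  moreover have "0 \<notin> G" using G(3)[of 0] emb_e by auto
  ultimately obtain m where m: "m \<ge> 1" "insert e (F \<union> G) \<subseteq> square m"
    using finite_subset_square[of "insert e (F \<union> G)"] F(1) G(1) e by auto
  define S where "S = {s \<in> F \<union> G. cross v (emb s) > 0}"
  define U where "U = {w. \<forall>s\<in>S. cross w (emb s) > 0}"
  have "open U" unfolding U_def S_def using F(1) G(1) by (intro open_left_of_all) simp
  moreover have "v \<in> U" by (auto simp: U_def S_def)
  moreover have "codes_point X (left_square m w) 0" if w: "w \<in> U" "avoids m w" for w
  proof -
    have left_of_w: "cross w (emb s) > 0" if "s \<in> F \<union> G" "cross v (emb s) > 0" for s
      using w(1) that unfolding U_def S_def by blast
    show ?thesis
    proof (cases "cross w (emb e) > 0")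
      case True
      have "cross w (emb s) > 0" if "s \<in> F" for s
        using F(3)[OF that] left_of_w[of s] that True by auto
      then show ?thesis using m(2) by (intro codes_point_mono[OF F(2)]) (auto simp: left_square_def)
    next
      case False
      moreover have "cross w (emb e) \<noteq> 0" using w(2) m(2) by (auto simp: avoids_def)
      ultimately have neg: "cross w (emb e) < 0" by simp
      have "cross w (emb s) > 0" if "s \<in> G" for s
        using G(3)[OF that] left_of_w[of s] that neg by (auto simp: mult_pos_neg)
      then show ?thesis using m(2) by (intro codes_point_mono[OF G(2)]) (auto simp: left_square_def)
    qed
  qed
  ultimately show ?thesis using m(1) by blast
qed

text \<open>A square that works for a direction may be enlarged: fewer directions avoid the larger square,
  and more points are available for coding. So finitely many of the local neighbourhoods cover the
  unit circle, and the largest of their squares works for all directions.\<close>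

lemma uniform_coding:
  assumes X: "subshift A X"
    and dichotomy: "\<And>v. v \<noteq> 0 \<Longrightarrow>
      expansive X (left_half_space 0 v) \<or> closing_half_space X (left_half_space 0 v)"
  shows "\<exists>m\<ge>1. \<forall>w. w \<noteq> 0 \<longrightarrow> avoids m w \<longrightarrow> codes_point X (left_square m w) 0"
proof -
  define good where
    "good m w \<longleftrightarrow> (avoids m w \<longrightarrow> codes_point X (left_square m w) 0)" for m w
  have good_mono: "good n w" if "good m w" "m \<le> n" for m n w
    using that square_mono[OF that(2)] unfolding good_def avoids_def left_square_def
    by (blast intro: codes_point_mono)
  have "\<forall>v\<in>sphere 0 1. \<exists>U m. open U \<and> v \<in> U \<and> m \<ge> 1 \<and> (\<forall>w\<in>U. good m w)"
  proof
    fix v :: "real \<times> real" assume "v \<in> sphere 0 1"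
    then have "v \<noteq> 0" by auto
    from local_uniform_coding[OF X this dichotomy[OF this]]
    show "\<exists>U m. open U \<and> v \<in> U \<and> m \<ge> 1 \<and> (\<forall>w\<in>U. good m w)"
      unfolding good_def .
  qed
  then obtain U m where U: "\<And>v. v \<in> sphere 0 1 \<Longrightarrow> open (U v) \<and> v \<in> U v"
    and m: "\<And>v. v \<in> sphere 0 1 \<Longrightarrow> m v \<ge> 1 \<and> (\<forall>w\<in>U v. good (m v) w)"
    by metis
  have "compact (sphere (0 :: real \<times> real) 1)" by simp
  then obtain C where C: "C \<subseteq> sphere 0 1" "finite C" "sphere 0 1 \<subseteq> (\<Union>v\<in>C. U v)"
    by (rule compactE_image[of _ "sphere 0 1" U]) (use U in auto)
  define M where "M = Max (insert 1 (m ` C))"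
  have M: "m v \<le> M" if "v \<in> C" for v
    using C(2) that by (auto simp: M_def)
  have "M \<ge> 1" using C(2) by (simp add: M_def)
  have "good M w" if "w \<noteq> 0" for w
  proof -
    define w' where "w' = (1 / norm w) *\<^sub>R w"
    have "w' \<in> sphere 0 1" using that by (simp add: w'_def)
    then obtain v where v: "v \<in> C" "w' \<in> U v" using C(3) by blast
    then have "good M w'" using m C(1) M[OF v(1)] good_mono by blast
    moreover have "avoids M w' \<longleftrightarrow> avoids M w" "left_square M w' = left_square M w"
      using that unfolding avoids_def left_square_def w'_def cross_scaleR_left
      by (auto simp: zero_less_divide_iff)
    ultimately show ?thesis by (simp only: good_def)
  qed
  with \<open>M \<ge> 1\<close> show ?thesis unfolding good_def by blast
qed

section \<open>The coding zonotope\<close>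

definition zonotope :: "(int \<times> int) set \<Rightarrow> (real \<times> real) set" where
  "zonotope D = convex hull (\<lambda>I. emb (\<Sum>I)) ` Pow D"

lemma convex_zonotope: "convex (zonotope D)"
  by (simp add: zonotope_def)

lemma subset_sum_in_zonotope: "I \<subseteq> D \<Longrightarrow> emb (\<Sum>I) \<in> zonotope D"
  unfolding zonotope_def by (intro hull_inc) auto

lemma convex_integer_polygon_zonotope:
  assumes "finite D" "{(1, 0), (0, 1)} \<subseteq> D"
  shows "convex_integer_polygon (zonotope D)"
  unfolding convex_integer_polygon_def
proof (intro conjI allI impI)
  show "polytope (zonotope D)"
    unfolding polytope_def zonotope_def using assms(1)
    by (intro exI[of _ "(\<lambda>I. emb (\<Sum>I)) ` Pow D"]) simp
  show "interior (zonotope D) \<noteq> {}"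
  proof
    assume "interior (zonotope D) = {}"
    then obtain a b where a: "a \<noteq> 0" "zonotope D \<subseteq> {x. a \<bullet> x = b}"
      by (rule empty_interior_subset_hyperplane[OF convex_zonotope])
    have "emb 0 \<in> zonotope D" "emb (1, 0) \<in> zonotope D" "emb (0, 1) \<in> zonotope D"
      using subset_sum_in_zonotope[of "{}" D] subset_sum_in_zonotope[of "{(1, 0)}" D]
        subset_sum_in_zonotope[of "{(0, 1)}" D] assms(2) by auto
    then have "a \<bullet> emb 0 = b" "a \<bullet> emb (1, 0) = b" "a \<bullet> emb (0, 1) = b" using a(2) by blast+
    with a(1) show False by (cases a) (auto simp: emb_def inner_prod_def zero_prod_def)
  qed
  show "v \<in> range emb" if "v extreme_point_of zonotope D" for v
    using extreme_point_of_convex_hull[OF that[unfolded zonotope_def]] by blast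
qed

text \<open>A vertex is a subset sum of \<open>D\<close>, and it is not the midpoint of two other subset sums. So of
  each pair \<open>d\<close>, \<open>-d\<close> in \<open>D\<close>, exactly one occurs in this sum, and the vectors that can be added are
  those that do not occur. Since the polygon without the vertex is convex, the origin is not in the
  convex hull of these vectors, so they lie in an open half plane.\<close>

lemma zonotope_vertex:
  assumes fin: "finite D" and sym: "\<And>d. d \<in> D \<Longrightarrow> - d \<in> D" and "0 \<notin> D"
    and v: "v extreme_point_of zonotope D"
  shows "\<exists>w. w \<noteq> 0 \<and> (\<forall>d\<in>D. cross w (emb d) \<noteq> 0) \<and>
           (\<forall>d\<in>D. cross w (emb d) > 0 \<longrightarrow> v + emb d \<in> zonotope D)"
proof -
  obtain I where I: "I \<subseteq> D" "v = emb (\<Sum>I)"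
    using extreme_point_of_convex_hull[OF v[unfolded zonotope_def]] by blast
  have finI: "finite I" using I(1) fin finite_subset by blast
  have add: "v + emb d \<in> zonotope D" if "d \<in> D - I" for d
  proof -
    have "emb (\<Sum>(insert d I)) \<in> zonotope D"
      using that I by (intro subset_sum_in_zonotope) auto
    then show ?thesis using that finI I(2) by (simp add: add.commute)
  qed
  have remove: "v - emb d \<in> zonotope D" if "d \<in> I" for d
  proof -
    have "emb (\<Sum>(I - {d})) \<in> zonotope D"
      using I by (intro subset_sum_in_zonotope) auto
    then show ?thesis using that finI I(2) by (simp add: sum_diff1)
  qed
  have no_midpoint: False if "v + z \<in> zonotope D" "v - z \<in> zonotope D" "z \<noteq> 0" for z
  proof -
    have "midpoint (v + z) (v - z) = v"
      by (simp add: midpoint_eq_iff)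
    moreover have "v + z \<noteq> v - z"
    proof
      assume "v + z = v - z"
      then have "2 *\<^sub>R z = 0" by (simp add: scaleR_2 eq_diff_eq add.assoc)
      then show False using that(3) by simp
    qed
    ultimately have "v \<in> open_segment (v + z) (v - z)"
      using midpoint_in_open_segment by metis
    then show False using v that by (auto simp: extreme_point_of_def)
  qed
  have half: "- d \<in> D - I \<longleftrightarrow> d \<in> I" if "d \<in> D" for d
  proof -
    have d: "emb d \<noteq> 0" "- d \<in> D" using that assms(3) sym emb_eq_iff[of d 0] by auto
    have "False" if "d \<in> I" "- d \<in> I"
      using remove[OF that(1)] remove[OF that(2)] no_midpoint d(1) by simp
    moreover have False if "d \<notin> I" "- d \<notin> I"
      using add[of d] add[of "- d"] \<open>d \<in> D\<close> that no_midpoint d by simp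
    ultimately show ?thesis using d(2) by blast
  qed
  define E where "E = emb ` (D - I)"
  have "0 \<notin> convex hull E"
  proof
    assume "0 \<in> convex hull E"
    then have "v \<in> (+) v ` (convex hull E)" by force
    then have "v \<in> convex hull ((+) v ` E)" by (simp add: convex_hull_translation)
    moreover have "(+) v ` E \<subseteq> zonotope D - {v}"
      using add assms(3) emb_eq_iff[of _ 0] by (auto simp: E_def)
    moreover have "convex (zonotope D - {v})"
      using v extreme_point_of_stillconvex convex_zonotope by blast
    ultimately show False by (metis Diff_iff hull_minimal singletonI subsetD)
  qed
  moreover have "closed (convex hull E)"
    unfolding E_def using fin by (intro compact_imp_closed finite_imp_compact_convex_hull) auto
  ultimately obtain a b where a: "a \<noteq> 0" "0 < b" "\<forall>x\<in>convex hull E. a \<bullet> x > b"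
    using separating_hyperplane_closed_0 convex_convex_hull by meson
  \<comment> \<open>The direction with normal vector \<open>a\<close> on its left.\<close>
  define w where "w = (snd a, - fst a)"
  have cross_w: "cross w x = a \<bullet> x" for x
    by (cases a; cases x) (simp add: w_def cross_def)
  have pos: "cross w (emb d) > 0" if "d \<in> D - I" for d
  proof -
    have "emb d \<in> convex hull E" using that by (auto simp: E_def intro: hull_inc)
    then have "b < cross w (emb d)" using a(3) cross_w by simp
    then show ?thesis using a(2) by simp
  qed
  have neg: "cross w (emb d) < 0" if "d \<in> I" for d
    using pos[of "- d"] half[of d] that I(1) by auto
  have "w \<noteq> 0" using a(1) by (cases a) (auto simp: w_def zero_prod_def)
  moreover have "cross w (emb d) \<noteq> 0" if "d \<in> D" for d
    using pos[of d] neg[of d] that by force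
  moreover have "v + emb d \<in> zonotope D" if "d \<in> D" "cross w (emb d) > 0" for d
    using neg[of d] add[of d] that by force
  ultimately show ?thesis by blast
qed

lemma coding_polygon_zonotope:
  assumes X: "subshift A X" and m: "m \<ge> 1"
    and uniform: "\<And>w. w \<noteq> 0 \<Longrightarrow> avoids m w \<Longrightarrow> codes_point X (left_square m w) 0"
  shows "coding_polygon X (zonotope (square m))"
  unfolding coding_polygon_def
proof (intro conjI allI impI)
  show P: "convex_integer_polygon (zonotope (square m))"
    using m by (intro convex_integer_polygon_zonotope finite_square) (auto simp: square_def zero_prod_def)
  fix v assume v: "v extreme_point_of zonotope (square m)"
  have zero: "0 \<notin> square m" by (simp add: square_def)
  from zonotope_vertex[OF finite_square uminus_square zero v]
  obtain w where w: "w \<noteq> 0" "avoids m w"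
      "\<forall>d\<in>left_square m w. v + emb d \<in> zonotope (square m)"
    by (auto simp: avoids_def left_square_def)
  obtain u where u: "v = emb u" using P v unfolding convex_integer_polygon_def by blast
  have "codes_point X ((\<lambda>s. s + u) ` left_square m w) (0 + u)"
    by (intro codes_point_translate[OF X] uniform w)
  moreover have "(\<lambda>s. s + u) ` left_square m w \<subseteq> emb -` (zonotope (square m) - {v})"
    using w(3) zero emb_eq_iff[of _ 0] by (auto simp: u add.commute left_square_def)
  ultimately have "codes_point X (emb -` (zonotope (square m) - {v})) u"
    using codes_point_mono by fastforce
  then show "codes X (zonotope (square m) - {v}) {v}"
    by (simp add: codes_iff_codes_point u)
qed

section \<open>Renaming the alphabet\<close>

lemma homeomorphic_map_relabel:
  assumes "inj_on g A"
  shows "homeomorphic_map (full_shift A) (full_shift (g ` A)) ((\<circ>) g)"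
proof -
  define h where "h = the_inv_into A g"
  have relabel: "continuous_map (full_shift A') (full_shift B') ((\<circ>) f)" if "f ` A' \<subseteq> B'"
    for f :: "'x \<Rightarrow> 'y" and A' B'
  proof -
    have "continuous_map (full_shift A') (discrete_topology B') (f \<circ> (\<lambda>x. x k))" for k
      unfolding full_shift_def
      by (rule continuous_map_compose[OF continuous_map_product_projection])
        (use that in auto)
    then show ?thesis
      unfolding full_shift_def[of B'] continuous_map_componentwise_UNIV by (simp add: o_def)
  qed
  have "homeomorphic_maps (full_shift A) (full_shift (g ` A)) ((\<circ>) g) ((\<circ>) h)"
    unfolding homeomorphic_maps_def
  proof (intro conjI ballI)
    show "continuous_map (full_shift A) (full_shift (g ` A)) ((\<circ>) g)" by (rule relabel) simp
    show "continuous_map (full_shift (g ` A)) (full_shift A) ((\<circ>) h)"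
      using assms by (intro relabel) (auto simp: h_def the_inv_into_f_f)
    show "h \<circ> (g \<circ> x) = x" if "x \<in> topspace (full_shift A)" for x
      using that assms by (auto simp: h_def full_shift_def fun_eq_iff PiE_iff the_inv_into_f_f)
    show "g \<circ> (h \<circ> y) = y" if "y \<in> topspace (full_shift (g ` A))" for y
      using that assms by (auto simp: h_def full_shift_def fun_eq_iff PiE_iff f_the_inv_into_f)
  qed
  then show ?thesis by (metis homeomorphic_map_maps)
qed

lemma subshift_values: "subshift A X \<Longrightarrow> x \<in> X \<Longrightarrow> x u \<in> A"
  unfolding subshift_def full_shift_def using closedin_subset by fastforce

lemma recoding_relabel:
  assumes X: "subshift A X" and g: "inj_on g A"
  shows "recoding A X (g ` A) ((\<circ>) g ` X)"
proof -
  let ?Y = "(\<circ>) g ` X"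
  have sub: "X \<subseteq> topspace (full_shift A)"
    using X by (auto simp: subshift_def dest: closedin_subset)
  note hom = homeomorphic_map_relabel[OF g]
  have clY: "closedin (full_shift (g ` A)) ?Y"
    using homeomorphic_map_closedness[OF hom sub] X by (simp add: subshift_def)
  have shift_g: "g \<circ> shift u x = shift u (g \<circ> x)" for u x
    by (auto simp: shift_def)
  have "shift u ` ?Y \<subseteq> ?Y" for u
  proof clarify
    fix x assume "x \<in> X"
    then have "shift u x \<in> X" using X unfolding subshift_def by blast
    then show "shift u (g \<circ> x) \<in> ?Y" by (auto simp flip: shift_g)
  qed
  then have Y: "subshift (g ` A) ?Y"
    using X clY by (auto simp: subshift_def)
  have "(\<circ>) g ` (topspace (full_shift A) \<inter> X) = topspace (full_shift (g ` A)) \<inter> ?Y"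
    using sub closedin_subset[OF clY] by (simp add: Int_absorb1)
  then have "homeomorphic_map (subtopology (full_shift A) X) (subtopology (full_shift (g ` A)) ?Y) ((\<circ>) g)"
    by (rule homeomorphic_map_subtopologies[OF hom])
  moreover have "(g \<circ> x) u = (g \<circ> x') u \<longleftrightarrow> agree_on ((\<lambda>f. f + u) ` {0}) x x'"
    if "x \<in> X" "x' \<in> X" for x x' u
    using that subshift_values[OF X] g by (auto simp: agree_on_def inj_on_eq_iff)
  ultimately show ?thesis
    unfolding recoding_def using Y shift_g
    by (intro conjI exI[of _ "{0}"] exI[of _ "(\<circ>) g"]) auto
qed

lemma polygonal_relabel:
  assumes X: "subshift A X" and g: "inj_on g A" and "polygonal X"
  shows "polygonal ((\<circ>) g ` X)"
proof -
  have g_eq: "g (x u) = g (x' u) \<longleftrightarrow> x u = x' u" if "x \<in> X" "x' \<in> X" for x x' u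
    using that subshift_values[OF X] g by (auto simp: inj_on_eq_iff)
  have "codes ((\<circ>) g ` X) S T \<longleftrightarrow> codes X S T" for S T
    by (simp add: codes_def agree_on_def g_eq)
  moreover have "inj_on ((\<circ>) g) X"
    by (rule inj_onI, rule ext) (metis comp_apply g_eq)
  ultimately show ?thesis
    using assms(3) by (auto simp: polygonal_def coding_polygon_def dest: finite_imageD)
qed

theorem theorem1p2:
  fixes A :: "'a set" and X :: "'a config set"
  assumes "subshift A X"
    and "infinite X"
    and "finite ({l. nonexpansive_ray X l} // translates)"
    and "\<And>l. nonexpansive_ray X l \<Longrightarrow> rational_ray l \<and> closing_ray X l"
  shows "\<exists>(B :: nat set) Y. recoding A X B Y \<and> polygonal Y"
proof -
  have "expansive X (left_half_space 0 v) \<or> closing_half_space X (left_half_space 0 v)"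
    if v: "v \<noteq> 0" for v
  proof (cases "expansive X (left_half_space 0 v)")
    case False
    then have "nonexpansive_ray X (ray 0 v)"
      using v unfolding nonexpansive_ray_def by blast
    then have "closing_ray X (ray 0 v)" using assms(4) by blast
    then have "closing_half_space X (left_half_space 0 v)"
      unfolding closing_ray_def using left_half_space_0_eq_of_ray_eq[OF v] by metis
    then show ?thesis ..
  qed simp
  then obtain m where "m \<ge> 1"
    "\<And>w. w \<noteq> 0 \<Longrightarrow> avoids m w \<Longrightarrow> codes_point X (left_square m w) 0"
    using uniform_coding[OF assms(1)] by metis
  then have "coding_polygon X (zonotope (square m))"
    using coding_polygon_zonotope[OF assms(1)] by blast
  then have "polygonal X" using assms(2) unfolding polygonal_def by blast
  have "countable A" using assms(1) by (auto simp: subshift_def intro: countable_finite)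
  then obtain g :: "'a \<Rightarrow> nat" where g: "inj_on g A" unfolding countable_def by blast
  show ?thesis
    using recoding_relabel[OF assms(1) g] polygonal_relabel[OF assms(1) g \<open>polygonal X\<close>] by blast
qed

end
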